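(* Let $\mathbf R=(R,\oplus,\cdot,0,1)$ be a ring-like structure of events (RLSE), and write $x':=x\oplus1$. Then $\mathbf R$ is a Boolean ring (with addition $\oplus$ and multiplication $\cdot$) if and only if $\mathbf R$ is weakly associative, i.e. satisfies $(x\oplus y)\oplus1=x\oplus(y\oplus1)$ for all $x,y$, and satisfies the identity $(xy'\oplus1)(x'y\oplus1)\oplus1= x\oplus y$ for all $x,y\in R$.
   Context: A ring-like structure of events (RLSE) is an algebra $(R,\oplus,\cdot,0,1)$ of type $(2,2,0,0)$ such that $(R,\cdot,1)$ is an idempotent commutative monoid with zero element $0$ (i.e. $x0=0$ for all $x$), satisfying the identities (R1) $x\oplus y= y\oplus x$; (R2) $(xy\oplus1)(x\oplus1)\oplus1= x$; (R3) $((xy\oplus1)x\oplus1)x= xy$; (R4) $xy\oplus(x\oplus1)=(xy\oplus1)x\oplus1$. *)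

theory Defs
  imports "HOL-Algebra.Ring"
begin

text \<open>An algebra of type \<open>(2,2,0,0)\<close> is a record of type \<^typ>\<open>'a ring\<close>; only its signature is
  used, no ring axioms are implied. All identities are relativised to the carrier.\<close>

locale rlse = comm_monoid R for R (structure) +
  assumes add_closed: "\<lbrakk>x \<in> carrier R; y \<in> carrier R\<rbrakk> \<Longrightarrow> x \<oplus> y \<in> carrier R"
    and zero_closed: "\<zero> \<in> carrier R"
    and mult_idem: "x \<in> carrier R \<Longrightarrow> x \<otimes> x = x"
    and mult_zero: "x \<in> carrier R \<Longrightarrow> x \<otimes> \<zero> = \<zero>"
    and R1: "\<lbrakk>x \<in> carrier R; y \<in> carrier R\<rbrakk> \<Longrightarrow> x \<oplus> y = y \<oplus> x"
    and R2: "\<lbrakk>x \<in> carrier R; y \<in> carrier R\<rbrakk> \<Longrightarrow>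
      (x \<otimes> y \<oplus> \<one>) \<otimes> (x \<oplus> \<one>) \<oplus> \<one> = x"
    and R3: "\<lbrakk>x \<in> carrier R; y \<in> carrier R\<rbrakk> \<Longrightarrow>
      ((x \<otimes> y \<oplus> \<one>) \<otimes> x \<oplus> \<one>) \<otimes> x = x \<otimes> y"
    and R4: "\<lbrakk>x \<in> carrier R; y \<in> carrier R\<rbrakk> \<Longrightarrow>
      x \<otimes> y \<oplus> (x \<oplus> \<one>) = (x \<otimes> y \<oplus> \<one>) \<otimes> x \<oplus> \<one>"

locale boolean_ring = ring R for R (structure) +
  assumes mult_idem: "x \<in> carrier R \<Longrightarrow> x \<otimes> x = x"

definition rlse_compl :: "('a, 'b) ring_scheme \<Rightarrow> 'a \<Rightarrow> 'a" where
  "rlse_compl R x = x \<oplus>\<^bsub>R\<^esub> \<one>\<^bsub>R\<^esub>"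

definition weakly_associative :: "('a, 'b) ring_scheme \<Rightarrow> bool" where
  "weakly_associative R \<longleftrightarrow> (\<forall>x\<in>carrier R. \<forall>y\<in>carrier R.
     (x \<oplus>\<^bsub>R\<^esub> y) \<oplus>\<^bsub>R\<^esub> \<one>\<^bsub>R\<^esub> = x \<oplus>\<^bsub>R\<^esub> (y \<oplus>\<^bsub>R\<^esub> \<one>\<^bsub>R\<^esub>))"

end

theory Submission
  imports Defs
begin

text \<open>
  An RLSE is an orthomodular lattice with meet \<open>xy\<close> and orthocomplement \<open>x' = x \<oplus> 1\<close>. If
  \<open>x \<oplus> y = xy' \<or> x'y\<close>, then weak associativity \<open>(x \<oplus> y)' = x \<oplus> y'\<close> says that
  \<open>xy \<or> xy' \<or> x'y \<or> x'y' = 1\<close>, which by orthomodularity forces \<open>x = xy \<or> xy'\<close>: any two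
  elements commute. Hence the lattice is Boolean and \<open>\<oplus>\<close> is its symmetric difference.
\<close>

context rlse
begin

abbreviation compl :: "'a \<Rightarrow> 'a" (\<open>\<sim> _\<close> [81] 80)
  where "\<sim> x \<equiv> rlse_compl R x"

lemma compl_closed [simp, intro]: "x \<in> carrier R \<Longrightarrow> \<sim> x \<in> carrier R"
  by (simp add: rlse_compl_def add_closed)

lemma zero_carrier [simp, intro]: "\<zero> \<in> carrier R"
  by (rule zero_closed)

lemma mult_idem_left:
  assumes "x \<in> carrier R" "y \<in> carrier R"
  shows "x \<otimes> (x \<otimes> y) = x \<otimes> y"
  using assms by (metis m_assoc mult_idem)

lemma zero_mult: "x \<in> carrier R \<Longrightarrow> \<zero> \<otimes> x = \<zero>"
  by (metis m_comm mult_zero zero_closed)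

text \<open>This is \<open>R2\<close> at y = 1, where idempotence collapses x'x' to x'.\<close>

lemma compl_compl: "x \<in> carrier R \<Longrightarrow> \<sim> (\<sim> x) = x"
  using R2[of x \<one>] by (simp add: rlse_compl_def add_closed mult_idem)

text \<open>Complementing both sides of \<open>R2\<close> gives this. In the order where a \<le> b
  means ab = a, it turns xy \<le> x into x' \<le> (xy)', the source of antitonicity.\<close>

lemma compl_mult_absorb:
  assumes "x \<in> carrier R" "y \<in> carrier R"
  shows "\<sim> (x \<otimes> y) \<otimes> \<sim> x = \<sim> x"
  using R2[OF assms] compl_compl[of "\<sim> (x \<otimes> y) \<otimes> \<sim> x"] assms
  unfolding rlse_compl_def[symmetric] by (simp add: compl_closed)

lemma compl_antimono:
  assumes "x \<in> carrier R" "y \<in> carrier R" "x \<otimes> y = x"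
  shows "\<sim> x \<otimes> \<sim> y = \<sim> y"
  using compl_mult_absorb[of y x] assms by (simp add: m_comm)

text \<open>For a = xy \<le> x, \<open>R3\<close> is the orthomodular law in its dual form: the meet
  of x with the join of x' and a is a.\<close>

lemma orthomodular:
  assumes "x \<in> carrier R" "y \<in> carrier R"
  shows "\<sim> (\<sim> (x \<otimes> y) \<otimes> x) \<otimes> x = x \<otimes> y"
  using R3[OF assms] by (simp add: rlse_compl_def)

lemma compl_zero: "\<sim> \<zero> = \<one>"
  using compl_mult_absorb[of "\<sim> \<one>" \<zero>] by (simp add: compl_compl mult_zero)

lemma compl_one: "\<sim> \<one> = \<zero>"
  using compl_compl[of \<zero>] by (simp add: compl_zero)

text \<open>At y = 0 the orthomodular law reduces to (1x)'x = 0.\<close>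

lemma mult_compl: "x \<in> carrier R \<Longrightarrow> x \<otimes> \<sim> x = \<zero>"
  using orthomodular[of x \<zero>] by (simp add: compl_zero mult_zero m_comm)

text \<open>An element a \<le> x with nothing of x left outside it is x itself: in the orthomodular
  law the inner product a'x is 0, and its complement 1 leaves x.\<close>

lemma eq_of_mult_compl_eq_zero:
  assumes "a \<in> carrier R" "x \<in> carrier R" "x \<otimes> a = a" "x \<otimes> \<sim> a = \<zero>"
  shows "a = x"
  using orthomodular[of x a] assms by (simp add: m_comm[of "\<sim> a"] compl_zero)

definition join :: "'a \<Rightarrow> 'a \<Rightarrow> 'a" (infixl \<open>\<squnion>\<close> 65)
  where "x \<squnion> y = \<sim> (\<sim> x \<otimes> \<sim> y)"

lemma join_closed [simp, intro]: "\<lbrakk>x \<in> carrier R; y \<in> carrier R\<rbrakk> \<Longrightarrow> x \<squnion> y \<in> carrier R"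
  by (simp add: join_def)

lemma compl_join: "\<lbrakk>x \<in> carrier R; y \<in> carrier R\<rbrakk> \<Longrightarrow> \<sim> (x \<squnion> y) = \<sim> x \<otimes> \<sim> y"
  by (simp add: join_def compl_compl)

text \<open>Complementation reverses the order, so x' lies below a' and b', hence below their meet;
  complement once more.\<close>

lemma join_least:
  assumes "x \<in> carrier R" "a \<in> carrier R" "b \<in> carrier R" "a \<otimes> x = a" "b \<otimes> x = b"
  shows "(a \<squnion> b) \<otimes> x = a \<squnion> b"
proof -
  have "\<sim> x \<otimes> (\<sim> a \<otimes> \<sim> b) = \<sim> x"
    using assms compl_antimono by (metis compl_closed m_assoc m_comm)
  then show ?thesis
    using compl_antimono[of "\<sim> x" "\<sim> a \<otimes> \<sim> b"] assms
    by (simp add: join_def compl_compl m_comm)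
qed

end

text \<open>The hypotheses of the converse direction; unfolding the join in \<open>add_eq\<close>
  gives back the second identity of the theorem.\<close>

locale xor_rlse = rlse +
  assumes weak_assoc: "\<lbrakk>x \<in> carrier R; y \<in> carrier R\<rbrakk> \<Longrightarrow> \<sim> (x \<oplus> y) = x \<oplus> \<sim> y"
    and add_eq: "\<lbrakk>x \<in> carrier R; y \<in> carrier R\<rbrakk> \<Longrightarrow> x \<oplus> y = (x \<otimes> \<sim> y) \<squnion> (\<sim> x \<otimes> y)"
begin

lemma commutes:
  assumes x: "x \<in> carrier R" and y: "y \<in> carrier R"
  shows "(x \<otimes> y) \<squnion> (x \<otimes> \<sim> y) = x"
proof (rule eq_of_mult_compl_eq_zero)
  let ?a = "(x \<otimes> y) \<squnion> (x \<otimes> \<sim> y)"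
  let ?p = "\<sim> (x \<otimes> y)" and ?q = "\<sim> (x \<otimes> \<sim> y)"
  let ?r = "\<sim> (\<sim> x \<otimes> y)" and ?s = "\<sim> (\<sim> x \<otimes> \<sim> y)"
  have cl: "?p \<in> carrier R" "?q \<in> carrier R" "?r \<in> carrier R" "?s \<in> carrier R"
    using x y by auto
  have "\<sim> (x \<oplus> y) = ?q \<otimes> ?r" "\<sim> (x \<oplus> \<sim> y) = ?p \<otimes> ?s"
    using x y by (simp_all add: add_eq compl_join compl_compl)
  \<comment> \<open>By weak associativity the two factors are complements of each other.\<close>
  moreover have "\<sim> (x \<oplus> y) \<otimes> \<sim> (x \<oplus> \<sim> y) = \<zero>"
    using x y weak_assoc[of x y, symmetric] by (simp add: mult_compl add_closed)
  ultimately have *: "(?q \<otimes> ?r) \<otimes> (?p \<otimes> ?s) = \<zero>"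
    by simp
  \<comment> \<open>Both \<open>?r\<close> and \<open>?s\<close> lie above x, so they can be
    inserted next to x for free. This completes the four-fold product that vanishes by
    \<open>*\<close>.\<close>
  have "\<sim> (\<sim> x \<otimes> y) \<otimes> x = x" "\<sim> (\<sim> x \<otimes> \<sim> y) \<otimes> x = x"
    using compl_mult_absorb[of "\<sim> x"] x y by (simp_all add: compl_compl)
  then have "(?p \<otimes> ?q) \<otimes> x = (?p \<otimes> ?q) \<otimes> (?r \<otimes> (?s \<otimes> x))"
    by simp
  also have "\<dots> = ((?q \<otimes> ?r) \<otimes> (?p \<otimes> ?s)) \<otimes> x"
    using x cl by (simp add: m_ac)
  also have "\<dots> = \<zero>"
    using * x by (simp add: zero_mult)
  finally show "x \<otimes> \<sim> ?a = \<zero>"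
    using x y cl by (simp add: compl_join m_comm)
  have "?a \<otimes> x = ?a"
    by (rule join_least) (use x y in \<open>simp_all add: m_ac mult_idem mult_idem_left\<close>)
  then show "x \<otimes> ?a = ?a"
    using x y by (simp add: m_comm)
qed (use x y in auto)

text \<open>By \<open>commutes\<close>, s is the join of sa and sa', and likewise t, so the parts
  below a and a' determine an element.\<close>

lemma eq_by_cases:
  assumes "a \<in> carrier R" "s \<in> carrier R" "t \<in> carrier R"
    and "a \<otimes> s = a \<otimes> t" "\<sim> a \<otimes> s = \<sim> a \<otimes> t"
  shows "s = t"
  using assms commutes[of s a] commutes[of t a] by (simp add: m_comm)

lemma mult_compl_mult:
  assumes x: "x \<in> carrier R" and y: "y \<in> carrier R"
  shows "x \<otimes> \<sim> (x \<otimes> y) = x \<otimes> \<sim> y"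
proof (rule eq_by_cases[of y])
  have "y \<otimes> (x \<otimes> \<sim> (x \<otimes> y)) = (x \<otimes> y) \<otimes> \<sim> (x \<otimes> y)"
    using x y by (simp add: m_ac)
  then show "y \<otimes> (x \<otimes> \<sim> (x \<otimes> y)) = y \<otimes> (x \<otimes> \<sim> y)"
    using x y by (simp add: mult_compl mult_zero m_lcomm[of y x])
  show "\<sim> y \<otimes> (x \<otimes> \<sim> (x \<otimes> y)) = \<sim> y \<otimes> (x \<otimes> \<sim> y)"
    using compl_mult_absorb[of y x] x y
    by (simp add: m_lcomm[of "\<sim> y" x] m_comm mult_idem)
qed (use x y in auto)

lemma mult_join_distrib:
  assumes x: "x \<in> carrier R" and y: "y \<in> carrier R" and z: "z \<in> carrier R"
  shows "x \<otimes> (y \<squnion> z) = (x \<otimes> y) \<squnion> (x \<otimes> z)"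
proof -
  let ?j = "(x \<otimes> y) \<squnion> (x \<otimes> z)"
  let ?u = "\<sim> (x \<otimes> y)" and ?v = "\<sim> (x \<otimes> z)"
  have "?j \<otimes> x = ?j"
    by (rule join_least) (use x y z in \<open>simp_all add: m_ac mult_idem mult_idem_left\<close>)
  then have "?j = x \<otimes> \<sim> (?u \<otimes> ?v)"
    using x y z by (simp add: join_def m_comm)
  \<comment> \<open>The inserted x is shared out between \<open>?u\<close> and \<open>?v\<close>,
    where it strips the x from each complement.\<close>
  also have "\<dots> = x \<otimes> \<sim> (x \<otimes> (?u \<otimes> ?v))"
    using x y z by (simp add: mult_compl_mult)
  also have "x \<otimes> (?u \<otimes> ?v) = (x \<otimes> ?u) \<otimes> (x \<otimes> ?v)"
    using x y z by (simp add: m_ac mult_idem_left)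
  also have "\<dots> = x \<otimes> (\<sim> y \<otimes> \<sim> z)"
    using x y z by (simp add: mult_compl_mult) (simp add: m_ac mult_idem_left)
  also have "x \<otimes> \<sim> (x \<otimes> (\<sim> y \<otimes> \<sim> z)) = x \<otimes> (y \<squnion> z)"
    using x y z by (simp add: mult_compl_mult join_def)
  finally show ?thesis ..
qed

lemma mult_add_distrib:
  assumes x: "x \<in> carrier R" and y: "y \<in> carrier R" and z: "z \<in> carrier R"
  shows "x \<otimes> (y \<oplus> z) = x \<otimes> y \<oplus> x \<otimes> z"
proof -
  have "(x \<otimes> y) \<otimes> \<sim> (x \<otimes> z) = y \<otimes> (x \<otimes> \<sim> (x \<otimes> z))"
    "\<sim> (x \<otimes> y) \<otimes> (x \<otimes> z) = (x \<otimes> \<sim> (x \<otimes> y)) \<otimes> z"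
    using x y z by (simp_all add: m_ac)
  then have "(x \<otimes> y) \<otimes> \<sim> (x \<otimes> z) = x \<otimes> (y \<otimes> \<sim> z)"
    "\<sim> (x \<otimes> y) \<otimes> (x \<otimes> z) = x \<otimes> (\<sim> y \<otimes> z)"
    using x y z by (simp_all add: mult_compl_mult m_ac)
  then show ?thesis
    using x y z by (simp add: add_eq mult_join_distrib)
qed

lemma zero_add: "x \<in> carrier R \<Longrightarrow> \<zero> \<oplus> x = x"
  by (simp add: add_eq join_def compl_zero compl_compl zero_mult)

lemma add_self: "x \<in> carrier R \<Longrightarrow> x \<oplus> x = \<zero>"
  by (simp add: add_eq join_def m_comm[of "\<sim> x"] mult_compl compl_zero compl_one)

text \<open>Distribute x over 1 \<oplus> y, which is y'.\<close>

lemma add_mult_self: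
  assumes "x \<in> carrier R" "y \<in> carrier R"
  shows "x \<oplus> x \<otimes> y = x \<otimes> \<sim> y"
  using mult_add_distrib[of x \<one> y] assms by (simp add: rlse_compl_def R1)

text \<open>Split along x. Below x both sides equal x(y \<oplus> z)', where weak associativity
  handles the left one; below x' the summand x disappears and both sides are x'y \<oplus>
  x'z.\<close>

lemma add_assoc:
  assumes x: "x \<in> carrier R" and y: "y \<in> carrier R" and z: "z \<in> carrier R"
  shows "(x \<oplus> y) \<oplus> z = x \<oplus> (y \<oplus> z)"
proof (rule eq_by_cases[of x])
  have "\<sim> y \<oplus> z = \<sim> (y \<oplus> z)"
    using weak_assoc[of z y] y z by (simp add: R1)
  then have "(x \<oplus> x \<otimes> y) \<oplus> x \<otimes> z = x \<otimes> \<sim> (y \<oplus> z)"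
    using x y z by (simp add: add_mult_self mult_add_distrib[symmetric])
  moreover have "x \<oplus> (x \<otimes> y \<oplus> x \<otimes> z) = x \<otimes> \<sim> (y \<oplus> z)"
    using x y z by (simp add: mult_add_distrib[symmetric] add_mult_self add_closed)
  ultimately show "x \<otimes> ((x \<oplus> y) \<oplus> z) = x \<otimes> (x \<oplus> (y \<oplus> z))"
    using x y z by (simp add: mult_add_distrib mult_idem add_closed)
  show "\<sim> x \<otimes> ((x \<oplus> y) \<oplus> z) = \<sim> x \<otimes> (x \<oplus> (y \<oplus> z))"
    using x y z
    by (simp add: mult_add_distrib add_closed m_comm[of "\<sim> x" x] mult_compl zero_add)
qed (use x y z in \<open>auto intro: add_closed\<close>)

lemma boolean_ring: "boolean_ring R"
proof -
  \<comment> \<open>Each element is its own additive inverse.\<close>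
  have "abelian_group R"
    by (rule abelian_groupI)
      (use add_self in \<open>auto intro: add_closed add_assoc R1 zero_add\<close>)
  then have "ring R"
    by (rule ringI) (auto intro: monoid_axioms mult_add_distrib
        simp: m_comm[of "_ \<oplus> _"] m_comm mult_add_distrib add_closed)
  then show ?thesis
    by (auto intro!: boolean_ring.intro boolean_ring_axioms.intro mult_idem)
qed

end

lemma (in boolean_ring) add_self:
  assumes x: "x \<in> carrier R"
  shows "x \<oplus> x = \<zero>"
proof -
  have "x \<oplus> x = (x \<oplus> x) \<otimes> (x \<oplus> x)"
    using x by (simp add: mult_idem)
  also have "\<dots> = (x \<oplus> x) \<oplus> (x \<oplus> x)"
    using x by (subst l_distr) (simp_all add: r_distr mult_idem)
  finally have "(x \<oplus> x) \<oplus> \<zero> = (x \<oplus> x) \<oplus> (x \<oplus> x)"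
    using x by simp
  then show ?thesis
    using x by simp
qed

lemma (in boolean_ring) add_self_left:
  "\<lbrakk>x \<in> carrier R; y \<in> carrier R\<rbrakk> \<Longrightarrow> x \<oplus> (x \<oplus> y) = y"
  by (simp add: a_assoc[symmetric] add_self)

lemma (in boolean_ring) xor_identity:
  assumes x: "x \<in> carrier R" and y: "y \<in> carrier R"
  shows "(x \<otimes> (y \<oplus> \<one>) \<oplus> \<one>) \<otimes> ((x \<oplus> \<one>) \<otimes> y \<oplus> \<one>) \<oplus> \<one> = x \<oplus> y"
proof -
  \<comment> \<open>These reduce the left-nested monomials of the expansion without commuting
    factors. Six copies of xy result and cancel in pairs, as do the two ones, leaving x \<oplus>
    y.\<close>
  have "x \<otimes> y \<otimes> y = x \<otimes> y" "x \<otimes> y \<otimes> x \<otimes> y = x \<otimes> y"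
    using x y mult_idem[of y] mult_idem[of "x \<otimes> y"] by (simp_all add: m_assoc)
  then show ?thesis
    using x y by (simp add: l_distr r_distr m_assoc[symmetric] mult_idem a_ac add_self add_self_left)
qed

theorem theorem2p4:
  fixes R :: "('a, 'b) ring_scheme" (structure)
  assumes "rlse R"
  shows "boolean_ring R \<longleftrightarrow>
    weakly_associative R \<and>
    (\<forall>x\<in>carrier R. \<forall>y\<in>carrier R.
       (x \<otimes> rlse_compl R y \<oplus> \<one>) \<otimes> (rlse_compl R x \<otimes> y \<oplus> \<one>) \<oplus> \<one> = x \<oplus> y)"
    (is "_ \<longleftrightarrow> ?W \<and> ?I")
proof
  interpret rlse R by fact
  {
    assume "boolean_ring R"
    then interpret B: boolean_ring R .
    show "?W \<and> ?I"
      using B.xor_identity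
      by (simp add: weakly_associative_def rlse_compl_def B.a_assoc)
  next
    assume "?W \<and> ?I"
    then have "xor_rlse R"
      by unfold_locales
        (auto simp: weakly_associative_def rlse_compl_def join_def)
    then show "boolean_ring R"
      by (rule xor_rlse.boolean_ring)
  }
qed

end
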